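(* Let $H$ be a Hausdorff, abelian, cancellative and reduced topological monoid that allows arbitrary decimation. Then its topological factorisation monoid $Z(H)$ is topologically prime factorial; that is, every $f \in Z(H)$ with $f \neq 0$ can be written as a convergent sum in $Z(H)$ of topologically prime elements of $Z(H)$, and any two such expressions of $f$ are equivalent.
   Context: A topological monoid is a monoid $K$ with a topology such that the operation $K\times K\to K$ is continuous. It is reduced if its only unit is the neutral element. For a reduced abelian monoid $K$, $K^*$ denotes the set of non-neutral elements. $H$ is written multiplicatively, with neutral element $1$. Convergent products: for a family $(f_j)_{j\in J}$ in a Hausdorff abelian topological monoid $K$ ($J$ any set), the product $\prod_{j\in J} f_j$ converges to $g\in K$ if for every neighbourhood $U$ of $g$ there is a finite $S\subset J$ such that $\prod_{j\in T} f_j\in U$ for all finite $T$ with $S\subset T\subset J$. If $K$ is written additively, one speaks of convergent sums. $K$ allows arbitrary decimation if whenever $\prod_{s\in S} e_s$ converges in $K$ and $T\subset S$, then $\prod_{s\in T} e_s$ converges in $K$. $a\mid b$ in $K$ means $ac=b$ for some $c\in K$. An atom (irreducible element) is $p\in K^*$ such that $p=a_1\cdots a_r$ with $a_i\in K$ implies $p=a_j$ for some $j$; $\mathcal{A}(K)$ is the set of atoms. An element $p\in K^*$ is topologically prime if whenever $p$ divides a convergent product, it divides some factor. Two convergent factorisations $\prod_{i\in I}a_i=\prod_{j\in J}b_j$ of the same element into elements of $K^*$ are equivalent if $\#\{i\in I: a_i=h\}=\#\{j\in J: b_j=h\}$ for all $h\in K^*$. $K$ is topologically prime factorial if every element of $K^*$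 is a convergent product of topologically prime elements and any two such factorisations of the same element are equivalent. The topological factorisation monoid of $H$: let $\mathbb{N}=\{0,1,2,\dots\}$, and let $\mathbb{N}^{\mathcal{A}(H)}$ be the monoid of all functions $\mathcal{A}(H)\to\mathbb{N}$ under pointwise addition. For $v\in\mathbb{N}^{\mathcal{A}(H)}$, the product $\prod_{a\in\mathcal{A}(H)}a^{v(a)}$ is understood as the product of the family in which each atom $a$ occurs $v(a)$ times, i.e. the family indexed by $\{(a,k): a\in\mathcal{A}(H),\ 1\le k\le v(a)\}$ whose $(a,k)$ member is $a$. $Z(H)$ is the set of $v\in\mathbb{N}^{\mathcal{A}(H)}$ for which this product converges in $H$; it is a submonoid of $\mathbb{N}^{\mathcal{A}(H)}$. The map $\overline{\pi_H}:Z(H)\to H$ is $v\mapsto\prod_{a\in\mathcal{A}(H)}a^{v(a)}$. $Z(H)$ carries the initial topology with respect to $\overline{\pi_H}$ and all projections $\mathrm{pr}_a:Z(H)\to\mathbb{N}$, $v\mapsto v(a)$ ($a\in\mathcal{A}(H)$, $\mathbb{N}$ discrete); this topology is Hausdorff. *)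

theory Defs
  imports
    "HOL-Algebra.Divisibility"
    "HOL-Algebra.FiniteProduct"
    "HOL-Analysis.Function_Topology"
    "HOL-Analysis.T1_Spaces"
    "HOL-Library.Equipollence"
begin

section \<open>Topological monoids and convergent products\<close>

record 'a top_monoid = "'a monoid" +
  topo :: "'a topology"

locale topological_comm_monoid = comm_monoid K for K :: "('a, 'm) top_monoid_scheme" (structure) +
  assumes topspace_topo: "topspace (topo K) = carrier K"
    and continuous_mult:
      "continuous_map (prod_topology (topo K) (topo K)) (topo K) (\<lambda>(x, y). x \<otimes> y)"

definition reduced_monoid :: "('a, 'm) monoid_scheme \<Rightarrow> bool" where
  "reduced_monoid K \<longleftrightarrow> Units K = {\<one>\<^bsub>K\<^esub>}"

definition nonneutral :: "('a, 'm) monoid_scheme \<Rightarrow> 'a set" where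
  "nonneutral K = carrier K - {\<one>\<^bsub>K\<^esub>}"

definition has_product ::
    "('a, 'm) top_monoid_scheme \<Rightarrow> ('i \<Rightarrow> 'a) \<Rightarrow> 'i set \<Rightarrow> 'a \<Rightarrow> bool" where
  "has_product K f J g \<longleftrightarrow>
     f \<in> J \<rightarrow> carrier K \<and>
     limitin (topo K) (\<lambda>T. finprod K f T) g (finite_subsets_at_top J)"

definition convergent_product ::
    "('a, 'm) top_monoid_scheme \<Rightarrow> ('i \<Rightarrow> 'a) \<Rightarrow> 'i set \<Rightarrow> bool" where
  "convergent_product K f J \<longleftrightarrow> (\<exists>g. has_product K f J g)"

text \<open>The limit is unique when the topology of the monoid is Hausdorff.\<close>
definition product_value ::
    "('a, 'm) top_monoid_scheme \<Rightarrow> ('i \<Rightarrow> 'a) \<Rightarrow> 'i set \<Rightarrow> 'a" where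
  "product_value K f J = (THE g. has_product K f J g)"

text \<open>
  The following notions refer to families over arbitrary index sets, but a definition cannot
  quantify over the index type. Families in a monoid with
  element type \<open>'a\<close> are therefore taken over subsets of \<^typ>\<open>'a \<times> nat\<close>. This loses no generality: convergence of
  a family and its limits depend only on how often each element occurs, and all infinite
  multiplicities have the same effect. In a topological commutative
  monoid, the lemmas \<open>convergent_product_decimate\<close> and \<open>topologically_prime_divides_factor\<close>
  below give both properties for every index type, and
  \<open>topologically_prime_factorisation_canonical\<close> does the same for the existence of factorisations.
\<close>

definition allows_arbitrary_decimation :: "('a, 'm) top_monoid_scheme \<Rightarrow> bool" where
  "allows_arbitrary_decimation K \<longleftrightarrow>
     (\<forall>(e :: 'a \<times> nat \<Rightarrow> 'a) S T.
        convergent_product K e S \<longrightarrow> T \<subseteq> S \<longrightarrow> convergent_product K e T)"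

definition topologically_prime :: "('a, 'm) top_monoid_scheme \<Rightarrow> 'a \<Rightarrow> bool" where
  "topologically_prime K p \<longleftrightarrow>
     p \<in> nonneutral K \<and>
     (\<forall>(f :: 'a \<times> nat \<Rightarrow> 'a) J g.
        has_product K f J g \<longrightarrow> p divides\<^bsub>K\<^esub> g \<longrightarrow> (\<exists>j\<in>J. p divides\<^bsub>K\<^esub> f j))"

definition atoms :: "('a, 'm) monoid_scheme \<Rightarrow> 'a set" where
  "atoms K = {p \<in> nonneutral K.
     \<forall>(r::nat) a. a \<in> {1..r} \<rightarrow> carrier K \<longrightarrow> p = finprod K a {1..r} \<longrightarrow> (\<exists>j\<in>{1..r}. p = a j)}"

section \<open>Topologically prime factorial monoids\<close>

definition topologically_prime_factorisation ::
    "('a, 'm) top_monoid_scheme \<Rightarrow> ('i \<Rightarrow> 'a) \<Rightarrow> 'i set \<Rightarrow> 'a \<Rightarrow> bool" where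
  "topologically_prime_factorisation K a J f \<longleftrightarrow>
     (\<forall>j\<in>J. topologically_prime K (a j)) \<and> has_product K a J f"

definition equivalent_factorisations ::
    "('a, 'm) monoid_scheme \<Rightarrow> ('i \<Rightarrow> 'a) \<Rightarrow> 'i set \<Rightarrow> ('j \<Rightarrow> 'a) \<Rightarrow> 'j set \<Rightarrow> bool" where
  "equivalent_factorisations K a I b J \<longleftrightarrow>
     (\<forall>h\<in>nonneutral K. {i \<in> I. a i = h} \<approx> {j \<in> J. b j = h})"

text \<open>
  Uniqueness compares multiplicities as cardinals, so here the index types matter and are explicit
  parameters: a theorem about \<open>topologically_prime_factorial TYPE('i) TYPE('j) K\<close> with \<open>'i\<close>
  and \<open>'j\<close> type variables covers all pairs of index sets.
\<close>
definition topologically_prime_factorial ::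
    "'i itself \<Rightarrow> 'j itself \<Rightarrow> ('a, 'm) top_monoid_scheme \<Rightarrow> bool" where
  "topologically_prime_factorial (_ :: 'i itself) (_ :: 'j itself) K \<longleftrightarrow>
     (\<forall>f\<in>nonneutral K. \<exists>(a :: 'a \<times> nat \<Rightarrow> 'a) J. topologically_prime_factorisation K a J f) \<and>
     (\<forall>f\<in>nonneutral K. \<forall>(a :: 'i \<Rightarrow> 'a) I (b :: 'j \<Rightarrow> 'a) J.
        topologically_prime_factorisation K a I f \<longrightarrow>
        topologically_prime_factorisation K b J f \<longrightarrow>
        equivalent_factorisations K a I b J)"

section \<open>The topological factorisation monoid\<close>

definition atom_copies :: "('a, 'm) monoid_scheme \<Rightarrow> ('a \<Rightarrow> nat) \<Rightarrow> ('a \<times> nat) set" where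
  "atom_copies H v = {(a, k). a \<in> atoms H \<and> 1 \<le> k \<and> k \<le> v a}"

text \<open>Functions on the atoms are represented as functions that vanish outside the atoms.\<close>
definition Z_carrier :: "('a, 'm) top_monoid_scheme \<Rightarrow> ('a \<Rightarrow> nat) set" where
  "Z_carrier H = {v. (\<forall>a. a \<notin> atoms H \<longrightarrow> v a = 0) \<and> convergent_product H fst (atom_copies H v)}"

definition Z_proj :: "('a, 'm) top_monoid_scheme \<Rightarrow> ('a \<Rightarrow> nat) \<Rightarrow> 'a" where
  "Z_proj H v = product_value H fst (atom_copies H v)"

definition Z_topology :: "('a, 'm) top_monoid_scheme \<Rightarrow> ('a \<Rightarrow> nat) topology" where
  "Z_topology H = topology_generated_by
     ({{v \<in> Z_carrier H. Z_proj H v \<in> U} | U. openin (topo H) U} \<union>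
      {{v \<in> Z_carrier H. v a \<in> N} | a N. a \<in> atoms H})"

definition Z_monoid :: "('a, 'm) top_monoid_scheme \<Rightarrow> ('a \<Rightarrow> nat) top_monoid" where
  "Z_monoid H =
     \<lparr>carrier = Z_carrier H, mult = (\<lambda>u v a. u a + v a), one = (\<lambda>_. 0), topo = Z_topology H\<rparr>"

section \<open>Independence of the index type\<close>

definition multiplicities_le :: "('i \<Rightarrow> 'a) \<Rightarrow> 'i set \<Rightarrow> ('j \<Rightarrow> 'a) \<Rightarrow> 'j set \<Rightarrow> bool" where
  "multiplicities_le f J f' J' \<longleftrightarrow>
     (\<forall>h S. finite S \<longrightarrow> S \<subseteq> {j \<in> J. f j = h} \<longrightarrow>
        (\<exists>S'. finite S' \<and> S' \<subseteq> {j \<in> J'. f' j = h} \<and> card S' = card S))"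

lemma count_fibre:
  "finite S \<Longrightarrow> count (image_mset f (mset_set S)) h = card {j \<in> S. f j = h}"
proof (induction S rule: finite_induct)
  case (insert x F)
  have "{j \<in> insert x F. f j = h} =
      (if f x = h then insert x {j \<in> F. f j = h} else {j \<in> F. f j = h})" by auto
  with insert show ?case by simp
qed simp

lemma extend_finite_subset:
  assumes le: "multiplicities_le f J f' J'" and T: "finite T" "T \<subseteq> J"
    and S': "finite S'" "S' \<subseteq> J'"
    and sub: "image_mset f' (mset_set S') \<subseteq># image_mset f (mset_set T)"
  obtains T' where "finite T'" "S' \<subseteq> T'" "T' \<subseteq> J'"
    "image_mset f' (mset_set T') = image_mset f (mset_set T)"
proof -
  let ?F = "\<lambda>T h. {j \<in> T. f j = h}" and ?F' = "\<lambda>T h. {j \<in> T. f' j = h}"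
  have "\<exists>B. finite B \<and> ?F' S' h \<subseteq> B \<and> B \<subseteq> ?F' J' h \<and> card B = card (?F T h)" for h
  proof -
    obtain X where X: "finite X" "X \<subseteq> ?F' J' h" "card X = card (?F T h)"
    proof -
      have "finite (?F T h)" "?F T h \<subseteq> ?F J h" using T by auto
      with le that show ?thesis unfolding multiplicities_le_def by metis
    qed
    have c: "card (?F' S' h) \<le> card (?F T h)"
      using mset_subset_eq_count[OF sub, of h] count_fibre[OF S'(1), of f' h]
        count_fibre[OF T(1), of f h] by simp
    have "card (?F T h) \<le> card (?F' S' h \<union> X)"
      unfolding X(3)[symmetric] using X(1) S'(1) by (intro card_mono) auto
    then obtain B where "?F' S' h \<subseteq> B" "B \<subseteq> ?F' S' h \<union> X" "card B = card (?F T h)"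
      using exists_subset_between[OF c, of "?F' S' h \<union> X"] X S'(1) by auto
    moreover have "finite B" "B \<subseteq> ?F' J' h"
      using calculation X S' by (auto intro: finite_subset[of B "?F' S' h \<union> X"])
    ultimately show ?thesis by blast
  qed
  then obtain B where "\<forall>h. finite (B h) \<and> ?F' S' h \<subseteq> B h \<and> B h \<subseteq> ?F' J' h \<and> card (B h) = card (?F T h)"
    using choice[of "\<lambda>h B. finite B \<and> ?F' S' h \<subseteq> B \<and> B \<subseteq> ?F' J' h \<and> card B = card (?F T h)"] by blast
  then have B: "\<And>h. finite (B h)" "\<And>h. ?F' S' h \<subseteq> B h" "\<And>h. B h \<subseteq> ?F' J' h"
    "\<And>h. card (B h) = card (?F T h)" by blast+
  define T' where "T' = (\<Union>h\<in>f ` T. B h)"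
  have fin: "finite T'" using B T by (auto simp: T'_def)
  have empty: "B h = {}" if "h \<notin> f ` T" for h
  proof -
    have "?F T h = {}" using that by auto
    with B(1,4)[of h] show ?thesis by simp
  qed
  have fibre: "?F' T' h = B h" for h
  proof
    show "?F' T' h \<subseteq> B h"
    proof
      fix x assume "x \<in> ?F' T' h"
      then obtain h' where "x \<in> B h'" "f' x = h" by (auto simp: T'_def)
      with B(3)[of h'] show "x \<in> B h" by auto
    qed
    show "B h \<subseteq> ?F' T' h"
      using B(3)[of h] empty[of h] by (cases "h \<in> f ` T") (auto simp: T'_def)
  qed
  have "S' \<subseteq> T'"
  proof
    fix s assume "s \<in> S'"
    then have "s \<in> B (f' s)" using B(2) by blast
    with fibre[of "f' s"] show "s \<in> T'" by blast
  qed
  moreover have "T' \<subseteq> J'" using B(3) by (fastforce simp: T'_def)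
  moreover have "image_mset f' (mset_set T') = image_mset f (mset_set T)"
    by (rule multiset_eqI) (simp only: count_fibre fin T fibre B(4))
  ultimately show thesis using fin that by blast
qed

context comm_monoid
begin

lemma finprod_cong_mset:
  assumes "finite T" "finite T'" "f \<in> T \<rightarrow> carrier G" "f' \<in> T' \<rightarrow> carrier G"
    and "image_mset f (mset_set T) = image_mset f' (mset_set T')"
  shows "finprod G f T = finprod G f' T'"
  using assms
proof (induction T arbitrary: T' rule: finite_induct)
  case empty
  then have "T' = {}" by (metis image_mset_empty image_mset_is_empty_iff mset_set.empty
        mset_set_empty_iff finite.emptyI)
  then show ?case by simp
next
  case (insert x F)
  have "f x \<in># image_mset f' (mset_set T')"
    unfolding insert.prems(4)[symmetric] using insert.hyps by simp
  then obtain y where y: "y \<in> T'" "f' y = f x" using insert.prems(1) by auto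
  have "image_mset f (mset_set F) = image_mset f' (mset_set (T' - {y}))"
  proof -
    have "mset_set T' = add_mset y (mset_set (T' - {y}))"
      using y insert.prems(1) by (simp add: mset_set.remove)
    then show ?thesis using insert.prems(4) insert.hyps y by simp
  qed
  then have IH: "finprod G f F = finprod G f' (T' - {y})"
    using insert.IH[of "T' - {y}"] insert.prems by auto
  have "finprod G f' (insert y (T' - {y})) = f' y \<otimes> finprod G f' (T' - {y})"
    using insert.prems y by (intro finprod_insert) auto
  moreover have "insert y (T' - {y}) = T'" using y by auto
  moreover have "finprod G f (insert x F) = f x \<otimes> finprod G f F"
    using insert.hyps insert.prems by (intro finprod_insert) auto
  ultimately show ?case using IH y by simp
qed

end

context topological_comm_monoid
begin

lemma has_product_transfer:
  assumes le: "multiplicities_le f J f' J'" and ge: "multiplicities_le f' J' f J"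
    and f': "f' \<in> J' \<rightarrow> carrier K" and hp: "has_product K f J g"
  shows "has_product K f' J' g"
proof -
  have f: "f \<in> J \<rightarrow> carrier K" using hp by (simp add: has_product_def)
  have "eventually (\<lambda>T. finprod K f' T \<in> U) (finite_subsets_at_top J')"
    if U: "openin (topo K) U" "g \<in> U" for U
  proof -
    from hp U obtain S where S: "finite S" "S \<subseteq> J"
      "\<And>T. finite T \<Longrightarrow> S \<subseteq> T \<Longrightarrow> T \<subseteq> J \<Longrightarrow> finprod K f T \<in> U"
      unfolding has_product_def limitin_def eventually_finite_subsets_at_top by meson
    obtain S' where S': "finite S'" "S' \<subseteq> J'"
      "image_mset f' (mset_set S') = image_mset f (mset_set S)"
      using extend_finite_subset[OF le S(1,2), of "{}"] by auto
    have "finprod K f' T' \<in> U" if T': "finite T'" "S' \<subseteq> T'" "T' \<subseteq> J'" for T'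
    proof -
      have "image_mset f (mset_set S) \<subseteq># image_mset f' (mset_set T')"
        unfolding S'(3)[symmetric]
        using T' by (intro image_mset_subseteq_mono) (simp add: finite_subset subset_imp_msubset_mset_set)
      then obtain T where T: "finite T" "S \<subseteq> T" "T \<subseteq> J"
        "image_mset f (mset_set T) = image_mset f' (mset_set T')"
        using extend_finite_subset[OF ge T'(1,3) S(1,2)] by metis
      have "finprod K f T = finprod K f' T'"
        using T T' f f' by (intro finprod_cong_mset) auto
      with S(3) T show ?thesis by metis
    qed
    with S' show ?thesis unfolding eventually_finite_subsets_at_top by blast
  qed
  then show ?thesis using hp f' by (auto simp: has_product_def limitin_def)
qed

end

definition canonical_index :: "('i \<Rightarrow> 'a) \<Rightarrow> 'i set \<Rightarrow> ('a \<times> nat) set" where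
  "canonical_index f J = {(h, k). \<exists>S. finite S \<and> S \<subseteq> {j \<in> J. f j = h} \<and> card S = Suc k}"

lemma canonical_index_mono: "T \<subseteq> J \<Longrightarrow> canonical_index f T \<subseteq> canonical_index f J"
  unfolding canonical_index_def by blast

lemma canonical_index_image: "(h, k) \<in> canonical_index f J \<Longrightarrow> h \<in> f ` J"
  unfolding canonical_index_def by (fastforce simp: card_Suc_eq)

lemma multiplicities_le_canonical: "multiplicities_le f J fst (canonical_index f J)"
  unfolding multiplicities_le_def
proof (intro allI impI)
  fix h S assume S: "finite S" "S \<subseteq> {j \<in> J. f j = h}"
  have "(h, k) \<in> canonical_index f J" if "k < card S" for k
  proof -
    from that have "Suc k \<le> card S" by simp
    then obtain S' where "S' \<subseteq> S" "card S' = Suc k" "finite S'"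
      by (rule obtain_subset_with_card_n)
    with S show ?thesis unfolding canonical_index_def by blast
  qed
  then show "\<exists>S'. finite S' \<and> S' \<subseteq> {j \<in> canonical_index f J. fst j = h} \<and> card S' = card S"
    by (intro exI[of _ "Pair h ` {..<card S}"]) (auto simp: card_image inj_on_def)
qed

lemma canonical_multiplicities_le: "multiplicities_le fst (canonical_index f J) f J"
  unfolding multiplicities_le_def
proof (intro allI impI)
  fix h and S :: "('a \<times> nat) set"
  assume S: "finite S" "S \<subseteq> {j \<in> canonical_index f J. fst j = h}"
  show "\<exists>S'. finite S' \<and> S' \<subseteq> {j \<in> J. f j = h} \<and> card S' = card S"
  proof (cases "S = {}")
    case True
    then show ?thesis by (intro exI[of _ "{}"]) auto
  next
    case False
    define m where "m = Max (snd ` S)"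
    have "m \<in> snd ` S" using False S(1) by (auto simp: m_def intro!: Max_in)
    then obtain p where "p \<in> S" "snd p = m" by blast
    with S(2) have "(h, m) \<in> canonical_index f J" by (cases p) auto
    then obtain X where X: "finite X" "X \<subseteq> {j \<in> J. f j = h}" "card X = Suc m"
      unfolding canonical_index_def by blast
    have "snd ` S \<subseteq> {..m}" using Max_ge[OF finite_imageI[OF S(1), of snd]] unfolding m_def by blast
    then have "card (snd ` S) \<le> Suc m" using card_mono[of "{..m}" "snd ` S"] by simp
    moreover have "card (snd ` S) = card S"
      using S(2) by (intro card_image) (auto simp: inj_on_def prod_eq_iff)
    ultimately have "card S \<le> card X" using X(3) by simp
    then obtain S' where "S' \<subseteq> X" "card S' = card S" "finite S'"
      by (rule obtain_subset_with_card_n)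
    with X show ?thesis by blast
  qed
qed

context topological_comm_monoid
begin

lemma has_product_canonical_iff:
  assumes "f \<in> J \<rightarrow> carrier K"
  shows "has_product K fst (canonical_index f J) g \<longleftrightarrow> has_product K f J g"
proof -
  have "fst \<in> canonical_index f J \<rightarrow> carrier K"
    using assms canonical_index_image[of _ _ f J] by fastforce
  then show ?thesis
    using has_product_transfer[OF multiplicities_le_canonical canonical_multiplicities_le]
      has_product_transfer[OF canonical_multiplicities_le multiplicities_le_canonical] assms by blast
qed

lemma convergent_product_decimate:
  fixes e :: "'i \<Rightarrow> 'a"
  assumes "allows_arbitrary_decimation K" "convergent_product K e S" "T \<subseteq> S"
  shows "convergent_product K e T"
proof -
  have e: "e \<in> S \<rightarrow> carrier K" using assms(2) by (auto simp: convergent_product_def has_product_def)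
  with assms(2) have "convergent_product K fst (canonical_index e S)"
    by (simp add: convergent_product_def has_product_canonical_iff)
  with assms(1,3) have "convergent_product K fst (canonical_index e T)"
    using canonical_index_mono[of T S e] unfolding allows_arbitrary_decimation_def by metis
  moreover have "e \<in> T \<rightarrow> carrier K" using e assms(3) by auto
  ultimately show ?thesis by (simp add: convergent_product_def has_product_canonical_iff)
qed

lemma topologically_prime_divides_factor:
  fixes f :: "'i \<Rightarrow> 'a"
  assumes "topologically_prime K p" "has_product K f J g" "p divides g"
  shows "\<exists>j\<in>J. p divides f j"
proof -
  have "has_product K fst (canonical_index f J) g"
    using assms(2) by (subst has_product_canonical_iff) (auto simp: has_product_def)
  with assms(1,3) have "\<exists>x\<in>canonical_index f J. p divides fst x"
    unfolding topologically_prime_def by blast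
  then obtain h k where "(h, k) \<in> canonical_index f J" "p divides h" by auto
  then show ?thesis using canonical_index_image[of h k f J] by blast
qed

lemma topologically_prime_factorisation_canonical:
  fixes a :: "'i \<Rightarrow> 'a"
  assumes "topologically_prime_factorisation K a J f"
  shows "topologically_prime_factorisation K fst (canonical_index a J) f"
proof -
  have "has_product K fst (canonical_index a J) f"
    using assms by (subst has_product_canonical_iff)
      (auto simp: has_product_def topologically_prime_factorisation_def)
  moreover have "topologically_prime K (fst x)" if "x \<in> canonical_index a J" for x
    using that assms canonical_index_image[of "fst x" "snd x" a J]
    by (auto simp: topologically_prime_factorisation_def)
  ultimately show ?thesis by (simp add: topologically_prime_factorisation_def)
qed

end

end

theory Submission
  imports Defs "HOL-Analysis.Abstract_Topological_Spaces"
begin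

text \<open>
  The topological primes of \<open>Z(H)\<close> are exactly the unit vectors \<open>e\<^sub>a\<close> of the atoms \<open>a\<close>: if
  \<open>e\<^sub>a\<close> divides a convergent sum, then continuity of the projection at \<open>a\<close> shows that some summand
  is positive at \<open>a\<close>, and decimation allows one to subtract \<open>e\<^sub>a\<close> from it inside \<open>Z(H)\<close>.
  Conversely every \<open>v\<close> is the convergent sum of the \<open>e\<^sub>a\<close>, each taken \<open>v(a)\<close> times, so a
  topological prime divides some \<open>e\<^sub>a\<close> and hence equals it. In any factorisation of \<open>v\<close>, continuity of
  the projection at \<open>a\<close> forces \<open>e\<^sub>a\<close> to occur exactly \<open>v(a)\<close> times.
\<close>

section \<open>Convergent products under reindexing and disjoint union\<close>

lemma has_product_reindex:
  assumes "comm_monoid K" "inj_on \<phi> A"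
  shows "has_product K f (\<phi> ` A) g \<longleftrightarrow> has_product K (\<lambda>x. f (\<phi> x)) A g"
proof -
  interpret comm_monoid K by fact
  have Pi: "f \<in> \<phi> ` A \<rightarrow> carrier K \<longleftrightarrow> (\<lambda>x. f (\<phi> x)) \<in> A \<rightarrow> carrier K" by auto
  have "limitin (topo K) (finprod K f) g (finite_subsets_at_top (\<phi> ` A)) \<longleftrightarrow>
      limitin (topo K) (finprod K (\<lambda>x. f (\<phi> x))) g (finite_subsets_at_top A)"
    if f: "f \<in> \<phi> ` A \<rightarrow> carrier K"
  proof -
    have "finprod K f (\<phi> ` T) = finprod K (\<lambda>x. f (\<phi> x)) T" if "T \<subseteq> A" for T
      using f that inj_on_subset[OF assms(2) that] by (intro finprod_reindex) auto
    then have ev: "\<forall>\<^sub>F T in finite_subsets_at_top A. finprod K f (\<phi> ` T) = finprod K (\<lambda>x. f (\<phi> x)) T"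
      by (intro eventually_finite_subsets_at_top_weakI)
    have "(\<forall>\<^sub>F T in finite_subsets_at_top A. finprod K f (\<phi> ` T) \<in> U) \<longleftrightarrow>
        (\<forall>\<^sub>F T in finite_subsets_at_top A. finprod K (\<lambda>x. f (\<phi> x)) T \<in> U)" for U
      using ev by (rule eventually_cong) simp
    \<comment> \<open>The finite subsets of \<open>\<phi>\<close>
      A\<open>are the images of those of\<close>A\<open>, so its filter is the image filter under\<close>T
      \<mapsto> \<phi> \<open>T\<close>, and both limits run over the same partial products.\<close>
    then show ?thesis
      unfolding filtermap_image_finite_subsets_at_top[OF assms(2), symmetric]
        limitin_def eventually_filtermap by simp
  qed
  with Pi show ?thesis unfolding has_product_def by blast
qed

lemma has_product_unique:
  assumes "Hausdorff_space (topo K)" "has_product K f J g" "has_product K f J h"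
  shows "g = h"
  using assms unfolding has_product_def
  by (metis limitin_Hausdorff_unique finite_subsets_at_top_neq_bot)

lemma product_value_eq:
  assumes "Hausdorff_space (topo K)" "has_product K f J g"
  shows "product_value K f J = g"
  unfolding product_value_def
  using assms(2) has_product_unique[OF assms(1) _ assms(2)] by (rule the_equality)

text \<open>A finite \<open>X \<subseteq> A\<close> contained in \<open>T\<close> is also contained
  in \<open>T \<inter> A\<close>, so any bound that works for \<open>A\<close> works for
  \<open>B\<close>. This turns a limit over subsets of one piece into a limit over subsets of a
  larger index set.\<close>

lemma filterlim_inter_finite_subsets_at_top:
  assumes "A \<subseteq> B"
  shows "filterlim (\<lambda>T. T \<inter> A) (finite_subsets_at_top A) (finite_subsets_at_top B)"
  unfolding filterlim_iff
proof (intro allI impI)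
  fix P
  assume "eventually P (finite_subsets_at_top A)"
  then obtain X where X: "finite X" "X \<subseteq> A"
    and P: "\<forall>Y. finite Y \<and> X \<subseteq> Y \<and> Y \<subseteq> A \<longrightarrow> P Y"
    unfolding eventually_finite_subsets_at_top by (elim exE conjE)
  have "P (Y \<inter> A)" if "finite Y" "X \<subseteq> Y" for Y
    using that X(2) by (intro P[rule_format]) simp
  with X assms show "\<forall>\<^sub>F T in finite_subsets_at_top B. P (T \<inter> A)"
    unfolding eventually_finite_subsets_at_top by (intro exI[of _ X]) simp
qed

context topological_comm_monoid
begin

lemma has_product_finite:
  assumes "finite J" "f \<in> J \<rightarrow> carrier K"
  shows "has_product K f J (finprod K f J)"
  using assms by (auto simp: has_product_def limitin_def topspace_topo
      eventually_finite_subsets_at_top_finite)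

text \<open>The partial product over \<open>T\<close> splits into those over
  \<open>T \<inter> A\<close> and \<open>T \<inter> B\<close>; the pair of these converges to
  \<open>(g, h)\<close>, and joint continuity of the multiplication gives the limit.\<close>

lemma has_product_Un:
  assumes A: "has_product K f A g" and B: "has_product K f B h" and disj: "A \<inter> B = {}"
  shows "has_product K f (A \<union> B) (g \<otimes> h)"
proof -
  let ?F = "finite_subsets_at_top (A \<union> B)"
  have f: "f \<in> A \<rightarrow> carrier K" "f \<in> B \<rightarrow> carrier K" using A B by (auto simp: has_product_def)
  have lim: "limitin (topo K) (\<lambda>T. finprod K f (T \<inter> C)) x ?F"
    if "has_product K f C x" "C \<subseteq> A \<union> B" for C x
    using that filterlim_inter_finite_subsets_at_top[OF that(2)]
    unfolding has_product_def limitin_def filterlim_iff by blast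
  have "limitin (prod_topology (topo K) (topo K))
      (\<lambda>T. (finprod K f (T \<inter> A), finprod K f (T \<inter> B))) (g, h) ?F"
    unfolding limitin_pairwise o_def using lim A B by simp
  from continuous_map_limit[OF continuous_mult this]
  have "limitin (topo K) (\<lambda>T. finprod K f (T \<inter> A) \<otimes> finprod K f (T \<inter> B)) (g \<otimes> h) ?F"
    by (simp add: o_def)
  moreover have "\<forall>\<^sub>F T in ?F. finprod K f (T \<inter> A) \<otimes> finprod K f (T \<inter> B) = finprod K f T"
  proof (rule eventually_finite_subsets_at_top_weakI)
    fix T assume T: "finite T" "T \<subseteq> A \<union> B"
    then have "finprod K f ((T \<inter> A) \<union> (T \<inter> B)) = finprod K f (T \<inter> A) \<otimes> finprod K f (T \<inter> B)"
      using f disj by (intro finprod_Un_disjoint) auto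
    moreover have "(T \<inter> A) \<union> (T \<inter> B) = T" using T by blast
    ultimately show "finprod K f (T \<inter> A) \<otimes> finprod K f (T \<inter> B) = finprod K f T" by simp
  qed
  ultimately have "limitin (topo K) (\<lambda>T. finprod K f T) (g \<otimes> h) ?F"
    by (rule limitin_transform_eventually[rotated])
  with f show ?thesis by (auto simp: has_product_def)
qed

end

section \<open>Unit vectors and index sets of atom copies\<close>

definition unit_vector :: "'a \<Rightarrow> 'a \<Rightarrow> nat" where
  "unit_vector a = (\<lambda>b. if b = a then 1 else 0)"

lemma inj_unit_vector: "inj unit_vector"
  unfolding inj_def unit_vector_def by (metis zero_neq_one)

lemma le_unit_vector:
  assumes "\<And>b. v b \<le> unit_vector a b" "v \<noteq> (\<lambda>_. 0)"
  shows "v = unit_vector a"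
proof -
  have z: "v b = 0" if "b \<noteq> a" for b using assms(1)[of b] that by (simp add: unit_vector_def)
  have "v a \<noteq> 0" using z assms(2) by (metis ext)
  moreover have "v a \<le> 1" using assms(1)[of a] by (simp add: unit_vector_def)
  ultimately show ?thesis using z by (auto simp: unit_vector_def)
qed

lemma Z_monoid_simps [simp]:
  "carrier (Z_monoid H) = Z_carrier H" "mult (Z_monoid H) u v = (\<lambda>a. u a + v a)"
  "one (Z_monoid H) = (\<lambda>_. 0)" "topo (Z_monoid H) = Z_topology H"
  by (simp_all add: Z_monoid_def)

lemma atoms_closed: "a \<in> atoms H \<Longrightarrow> a \<in> carrier H"
  by (simp add: atoms_def nonneutral_def)

lemma atom_copies_zero: "atom_copies H (\<lambda>_. 0) = {}"
  by (auto simp: atom_copies_def)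

lemma atom_copies_unit_vector: "a \<in> atoms H \<Longrightarrow> atom_copies H (unit_vector a) = {(a, 1)}"
  by (auto simp: atom_copies_def unit_vector_def split: if_splits)

lemma atom_copies_mono: "(\<And>a. u a \<le> v a) \<Longrightarrow> atom_copies H u \<subseteq> atom_copies H v"
  unfolding atom_copies_def by (auto intro: order_trans)

text \<open>The copies of \<open>a\<close> counted by \<open>v\<close> are renumbered
  \<open>u a + 1, ..., u a + v a\<close>, after those counted by \<open>u\<close>. The two pieces
  are therefore disjoint, as \<open>has_product_Un\<close> requires.\<close>

lemma atom_copies_add:
  "atom_copies H (\<lambda>a. u a + v a) =
     atom_copies H u \<union> (\<lambda>(a, k). (a, k + u a)) ` atom_copies H v" (is "?L = ?R")
proof
  show "?L \<subseteq> ?R"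
  proof
    fix x assume x: "x \<in> ?L"
    show "x \<in> ?R"
    proof (cases "x \<in> atom_copies H u")
      case False
      \<comment> \<open>Here \<open>snd x > u (fst x)\<close>, so the subtraction is exact and
        undoes the shift.\<close>
      with x have "x = (\<lambda>(a, k). (a, k + u a)) (fst x, snd x - u (fst x))"
        "(fst x, snd x - u (fst x)) \<in> atom_copies H v"
        by (auto simp: atom_copies_def)
      then show ?thesis by blast
    qed simp
  qed
qed (auto simp: atom_copies_def)

section \<open>The initial topology on Z(H)\<close>

lemma topspace_Z_topology:
  assumes "v \<in> Z_carrier H" "Z_proj H v \<in> topspace (topo H)"
  shows "v \<in> topspace (Z_topology H)"
  \<comment> \<open>The topspace is the union of the generating sets, and the one given by
    \<open>U = topspace (topo H)\<close> contains \<open>v\<close>. This also covers an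
    \<open>H\<close> without atoms.\<close>
  using assms unfolding Z_topology_def topology_generated_by_topspace by blast

lemma openin_Z_topology_coordinate:
  "a \<in> atoms H \<Longrightarrow> openin (Z_topology H) {v \<in> Z_carrier H. v a \<in> N}"
  unfolding Z_topology_def by (rule topology_generated_by_Basis) blast

text \<open>Eventual membership passes to finite intersections and to unions, so it suffices to
  check the generating sets. As the naturals are discrete, convergence of a coordinate means being
  eventually equal to \<open>v a\<close>.\<close>

lemma limitin_Z_topologyI:
  assumes v: "v \<in> Z_carrier H" and carrier: "\<forall>\<^sub>F x in F. f x \<in> Z_carrier H"
    and proj: "limitin (topo H) (\<lambda>x. Z_proj H (f x)) (Z_proj H v) F"
    and coord: "\<And>a. a \<in> atoms H \<Longrightarrow> \<forall>\<^sub>F x in F. f x a = v a"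
  shows "limitin (Z_topology H) f v F"
proof -
  have "\<forall>\<^sub>F x in F. f x \<in> U" if "openin (Z_topology H) U" "v \<in> U" for U
    using openin_topology_generated_by[OF that(1)[unfolded Z_topology_def]] that(2)
  proof induction
    case (Int A B)
    then show ?case by (simp add: eventually_conj)
  next
    case (UN \<K>)
    then obtain A where "A \<in> \<K>" "\<forall>\<^sub>F x in F. f x \<in> A" by blast
    then show ?case by (auto elim: eventually_mono)
  next
    case (Basis A)
    then consider U where "A = {w \<in> Z_carrier H. Z_proj H w \<in> U}" "openin (topo H) U"
      | a N where "A = {w \<in> Z_carrier H. w a \<in> N}" "a \<in> atoms H" by blast
    then show ?case
    proof cases
      case 1
      then have "\<forall>\<^sub>F x in F. Z_proj H (f x) \<in> U"
        using proj Basis.prems by (auto simp: limitin_def)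
      with carrier show ?thesis unfolding 1(1) by eventually_elim simp
    next
      case 2
      have "v a \<in> N" using Basis.prems 2(1) by simp
      with coord[OF 2(2)] carrier show ?thesis
        unfolding 2(1) by (auto elim: eventually_elim2)
    qed
  qed simp
  moreover have "v \<in> topspace (Z_topology H)"
    using v limitin_topspace[OF proj] by (rule topspace_Z_topology)
  ultimately show ?thesis by (simp add: limitin_def)
qed

section \<open>Monoid structure and finite sums of Z(H)\<close>

locale decimable_monoid = topological_comm_monoid H
  for H :: "('a, 'm) top_monoid_scheme" (structure) +
  assumes Hausdorff: "Hausdorff_space (topo H)"
    and decimation: "allows_arbitrary_decimation H"
begin

abbreviation Z where "Z \<equiv> Z_monoid H"

lemma Z_projI: "has_product H fst (atom_copies H v) g \<Longrightarrow> Z_proj H v = g"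
  unfolding Z_proj_def by (rule product_value_eq[OF Hausdorff])

lemma Z_carrier_iff:
  "v \<in> Z_carrier H \<longleftrightarrow>
     (\<forall>a. a \<notin> atoms H \<longrightarrow> v a = 0) \<and> has_product H fst (atom_copies H v) (Z_proj H v)"
  unfolding Z_carrier_def convergent_product_def mem_Collect_eq using Z_projI by metis

lemma Z_carrier_has_product:
  "v \<in> Z_carrier H \<Longrightarrow> has_product H fst (atom_copies H v) (Z_proj H v)"
  by (simp add: Z_carrier_iff)

lemma Z_carrier_outside: "v \<in> Z_carrier H \<Longrightarrow> a \<notin> atoms H \<Longrightarrow> v a = 0"
  by (simp add: Z_carrier_def)

text \<open>This is where decimation enters: a smaller vector selects a subset of the atom copies.
  Being closed downwards, Z(H) admits subtraction of smaller vectors.\<close>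

lemma Z_carrier_le:
  assumes "v \<in> Z_carrier H" "\<And>a. u a \<le> v a"
  shows "u \<in> Z_carrier H"
proof -
  have "convergent_product H fst (atom_copies H u)"
    using assms decimation atom_copies_mono[of u v H]
    unfolding Z_carrier_def allows_arbitrary_decimation_def by blast
  moreover have "u a = 0" if "a \<notin> atoms H" for a
    using assms(2)[of a] Z_carrier_outside[OF assms(1) that] by simp
  ultimately show ?thesis by (simp add: Z_carrier_def)
qed

lemma has_product_zero: "has_product H fst (atom_copies H (\<lambda>_. 0)) \<one>"
  using has_product_finite[of "{}" fst] by (simp add: atom_copies_zero)

lemma has_product_unit_vector:
  "a \<in> atoms H \<Longrightarrow> has_product H fst (atom_copies H (unit_vector a)) a"
  using has_product_finite[of "{(a, 1)}" fst]
  by (simp add: atom_copies_unit_vector atoms_closed del: One_nat_def)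

lemma has_product_add:
  assumes "u \<in> Z_carrier H" "v \<in> Z_carrier H"
  shows "has_product H fst (atom_copies H (\<lambda>a. u a + v a)) (Z_proj H u \<otimes> Z_proj H v)"
  unfolding atom_copies_add
proof (rule has_product_Un)
  \<comment> \<open>The shift changes only the copy number, so the reindexed family still has the
    members counted by \<open>v\<close>.\<close>
  let ?s = "\<lambda>(a, k). (a, k + u a)"
  have "inj_on ?s (atom_copies H v)" by (auto simp: inj_on_def)
  moreover have "fst (?s x) = fst x" for x by (simp split: prod.split)
  ultimately show "has_product H fst (?s ` atom_copies H v) (Z_proj H v)"
    using Z_carrier_has_product[OF assms(2)]
    by (simp add: has_product_reindex[OF comm_monoid_axioms])
  show "has_product H fst (atom_copies H u) (Z_proj H u)"
    by (rule Z_carrier_has_product[OF assms(1)])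
qed (auto simp: atom_copies_def)

lemma zero_Z_carrier: "(\<lambda>_. 0) \<in> Z_carrier H"
  using has_product_zero by (auto simp: Z_carrier_def convergent_product_def)

lemma unit_vector_Z_carrier: "a \<in> atoms H \<Longrightarrow> unit_vector a \<in> Z_carrier H"
  using has_product_unit_vector[of a]
  by (auto simp: Z_carrier_def convergent_product_def) (auto simp: unit_vector_def)

lemma add_Z_carrier:
  "u \<in> Z_carrier H \<Longrightarrow> v \<in> Z_carrier H \<Longrightarrow> (\<lambda>a. u a + v a) \<in> Z_carrier H"
  using has_product_add[of u v] unfolding Z_carrier_def convergent_product_def by auto

lemma Z_comm_monoid: "comm_monoid Z"
  by (rule comm_monoidI) (auto simp: add_Z_carrier zero_Z_carrier ac_simps)

sublocale Z: comm_monoid Z by (rule Z_comm_monoid)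

lemma finprod_Z_closed: "f \<in> T \<rightarrow> Z_carrier H \<Longrightarrow> finprod Z f T \<in> Z_carrier H"
  using Z.finprod_closed[of f T] by simp

lemma finprod_Z_apply:
  assumes "finite T" "f \<in> T \<rightarrow> Z_carrier H"
  shows "finprod Z f T a = (\<Sum>t\<in>T. f t a)"
  using assms
proof (induction T rule: finite_induct)
  case (insert x F)
  then have "f \<in> F \<rightarrow> carrier Z" "f x \<in> carrier Z" by auto
  with insert show ?case by simp
qed simp

text \<open>Induction on \<open>has_product_add\<close>. It lets partial sums in Z(H) be compared
  with partial products in \<open>H\<close>.\<close>

lemma Z_proj_finprod:
  assumes "finite T" "f \<in> T \<rightarrow> Z_carrier H"
  shows "Z_proj H (finprod Z f T) = finprod H (\<lambda>t. Z_proj H (f t)) T"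
  using assms
proof (induction T rule: finite_induct)
  case empty
  show ?case using has_product_zero by (simp add: Z_projI)
next
  case (insert x F)
  have Z_proj_closed: "Z_proj H v \<in> carrier H" if "v \<in> Z_carrier H" for v
    using Z_carrier_has_product[OF that] limitin_topspace topspace_topo
    unfolding has_product_def by metis
  have f: "f \<in> F \<rightarrow> carrier Z" "f x \<in> carrier Z" using insert by auto
  then have "finprod Z f F \<in> Z_carrier H" by (intro finprod_Z_closed) simp
  then have "Z_proj H (finprod Z f (insert x F)) = Z_proj H (f x) \<otimes> Z_proj H (finprod Z f F)"
    using insert.hyps f has_product_add[of "f x" "finprod Z f F"] by (simp add: Z_projI)
  also have "\<dots> = finprod H (\<lambda>t. Z_proj H (f t)) (insert x F)"
    using insert f Z_proj_closed by (subst finprod_insert) (auto simp: Pi_iff)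
  finally show ?case .
qed

text \<open>The vectors of Z(H) with value \<open>v a\<close> at \<open>a\<close> form an open
  neighbourhood of \<open>v\<close>, so the partial sums at \<open>a\<close> are not merely
  convergent but eventually constant.\<close>

lemma has_product_Z_coordinate:
  assumes "has_product Z f J v" "a \<in> atoms H"
  obtains S where "finite S" "S \<subseteq> J"
    "\<And>T. finite T \<Longrightarrow> S \<subseteq> T \<Longrightarrow> T \<subseteq> J \<Longrightarrow> (\<Sum>t\<in>T. f t a) = v a"
proof -
  have f: "f \<in> J \<rightarrow> Z_carrier H" and lim: "limitin (Z_topology H) (finprod Z f) v (finite_subsets_at_top J)"
    using assms(1) by (auto simp: has_product_def)
  have "v \<in> Z_carrier H"
    using limitin_topspace[OF lim] unfolding Z_topology_def topology_generated_by_topspace by blast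
  then have "\<forall>\<^sub>F T in finite_subsets_at_top J. finprod Z f T \<in> {w \<in> Z_carrier H. w a \<in> {v a}}"
    using lim openin_Z_topology_coordinate[OF assms(2)] unfolding limitin_def by blast
  then obtain S where S: "finite S" "S \<subseteq> J"
    "\<And>T. finite T \<Longrightarrow> S \<subseteq> T \<Longrightarrow> T \<subseteq> J \<Longrightarrow> finprod Z f T a = v a"
    unfolding eventually_finite_subsets_at_top by auto
  show thesis
  proof (rule that[OF S(1,2)])
    fix T assume T: "finite T" "S \<subseteq> T" "T \<subseteq> J"
    with f have "f \<in> T \<rightarrow> Z_carrier H" by blast
    with S(3)[OF T] T(1) show "(\<Sum>t\<in>T. f t a) = v a" by (simp add: finprod_Z_apply)
  qed
qed

section \<open>Divisibility and topological primes in Z(H)\<close>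

lemma unit_vector_divides:
  assumes "v \<in> Z_carrier H" "v a > 0"
  shows "unit_vector a divides\<^bsub>Z\<^esub> v"
proof -
  have "(\<lambda>b. v b - unit_vector a b) \<in> Z_carrier H"
    using assms(1) by (rule Z_carrier_le) simp
  \<comment> \<open>Truncated subtraction is exact because \<open>v a > 0\<close>.\<close>
  moreover have "v = unit_vector a \<otimes>\<^bsub>Z\<^esub> (\<lambda>b. v b - unit_vector a b)"
    using assms(2) by (auto simp: unit_vector_def)
  ultimately show ?thesis unfolding factor_def by auto
qed

lemma divides_Z_le: "u divides\<^bsub>Z\<^esub> v \<Longrightarrow> u a \<le> v a"
  by (auto simp: factor_def)

lemma topologically_prime_unit_vector:
  assumes "a \<in> atoms H"
  shows "topologically_prime Z (unit_vector a)"
  unfolding topologically_prime_def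
proof (intro conjI allI impI)
  have "unit_vector a a \<noteq> 0" by (simp add: unit_vector_def)
  then show "unit_vector a \<in> nonneutral Z"
    using unit_vector_Z_carrier[OF assms] by (auto simp: nonneutral_def)
next
  fix f :: "('a \<Rightarrow> nat) \<times> nat \<Rightarrow> 'a \<Rightarrow> nat" and J g
  assume hp: "has_product Z f J g" and dvd: "unit_vector a divides\<^bsub>Z\<^esub> g"
  obtain S where S: "finite S" "S \<subseteq> J" "(\<Sum>t\<in>S. f t a) = g a"
    using has_product_Z_coordinate[OF hp assms] by (metis order_refl)
  moreover have "1 \<le> g a" using divides_Z_le[OF dvd, of a] by (simp add: unit_vector_def)
  \<comment> \<open>The finite sum of the \<open>f t a\<close> over \<open>S\<close> equals
    \<open>g a\<close>, which is at least 1, so one of its terms is positive.\<close>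
  ultimately obtain j where "j \<in> S" "f j a > 0"
    by (metis gr0I not_one_le_zero sum.neutral)
  with S(2) hp show "\<exists>j\<in>J. unit_vector a divides\<^bsub>Z\<^esub> f j"
    by (intro bexI[of _ j] unit_vector_divides) (auto simp: has_product_def)
qed

text \<open>Since \<open>Z_proj\<close> sends \<open>unit_vector a\<close> to \<open>a\<close>, the
  partial sums project to the partial products defining \<open>Z_proj H v\<close>, which converge
  because \<open>v\<close> lies in Z(H). It remains to check each coordinate.\<close>

lemma has_product_unit_vectors:
  assumes v: "v \<in> Z_carrier H"
  shows "has_product Z (\<lambda>x. unit_vector (fst x)) (atom_copies H v) v"
proof -
  let ?A = "atom_copies H v" and ?e = "\<lambda>x. unit_vector (fst x)"
  have Z: "?e \<in> ?A \<rightarrow> Z_carrier H"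
    by (auto simp: atom_copies_def unit_vector_Z_carrier)
  have eZ: "?e \<in> T \<rightarrow> Z_carrier H" if "T \<subseteq> ?A" for T using Z that by blast
  have "limitin (Z_topology H) (finprod Z ?e) v (finite_subsets_at_top ?A)"
  proof (rule limitin_Z_topologyI[OF v])
    show "\<forall>\<^sub>F T in finite_subsets_at_top ?A. finprod Z ?e T \<in> Z_carrier H"
      by (intro eventually_finite_subsets_at_top_weakI finprod_Z_closed eZ)
  next
    have "\<forall>\<^sub>F T in finite_subsets_at_top ?A. finprod H fst T = Z_proj H (finprod Z ?e T)"
    proof (rule eventually_finite_subsets_at_top_weakI)
      fix T assume T: "finite T" "T \<subseteq> ?A"
      then have "Z_proj H (?e t) = fst t" "fst t \<in> carrier H" if "t \<in> T" for t
        using that has_product_unit_vector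
        by (auto simp: atom_copies_def Z_projI atoms_closed)
      then have "finprod H (\<lambda>t. Z_proj H (?e t)) T = finprod H fst T"
        by (intro finprod_cong') auto
      then show "finprod H fst T = Z_proj H (finprod Z ?e T)"
        using T eZ by (simp add: Z_proj_finprod)
    qed
    then show "limitin (topo H) (\<lambda>T. Z_proj H (finprod Z ?e T)) (Z_proj H v) (finite_subsets_at_top ?A)"
      using Z_carrier_has_product[OF v] unfolding has_product_def
      by (blast intro: limitin_transform_eventually)
  next
    fix a assume a: "a \<in> atoms H"
    \<comment> \<open>All copies of \<open>a\<close> together form a finite set; once
      \<open>T\<close> contains it, exactly \<open>v a\<close> members of \<open>T\<close>
      contribute at \<open>a\<close>.\<close>
    let ?S = "Pair a ` {1..v a}"
    have S: "{x \<in> ?A. fst x = a} = ?S" using a by (auto simp: atom_copies_def)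
    have "finprod Z ?e T a = v a" if T: "finite T" "?S \<subseteq> T" "T \<subseteq> ?A" for T
    proof -
      have "finprod Z ?e T a = (\<Sum>t\<in>T. if fst t = a then 1 else 0)"
        using T eZ by (subst finprod_Z_apply) (auto simp: unit_vector_def intro!: sum.cong)
      also have "\<dots> = card {t \<in> T. fst t = a}"
        using T(1) by (simp add: sum.If_cases Int_def)
      also have "{t \<in> T. fst t = a} = ?S" using S T by blast
      finally show ?thesis by (simp add: card_image inj_on_def)
    qed
    moreover have "finite ?S" "?S \<subseteq> ?A" using S by auto
    ultimately show "\<forall>\<^sub>F T in finite_subsets_at_top ?A. finprod Z ?e T a = v a"
      unfolding eventually_finite_subsets_at_top by (intro exI[of _ ?S]) simp
  qed
  with Z show ?thesis by (simp add: has_product_def)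
qed

text \<open>Indexing by the copies of the vectors themselves fits the index type fixed in the definitions.\<close>
lemma has_product_unit_vectors_fst:
  assumes "v \<in> Z_carrier H"
  shows "has_product Z fst (map_prod unit_vector id ` atom_copies H v) v"
proof -
  have "inj_on (map_prod unit_vector id) (atom_copies H v)"
    by (rule inj_on_subset[OF prod.inj_map[OF inj_unit_vector inj_on_id]]) simp
  then show ?thesis
    using has_product_unit_vectors[OF assms]
    by (simp add: has_product_reindex[OF Z_comm_monoid])
qed

lemma topologically_prime_Z_iff:
  "topologically_prime Z p \<longleftrightarrow> p \<in> unit_vector ` atoms H"
proof
  assume p: "topologically_prime Z p"
  then have pZ: "p \<in> Z_carrier H" "p \<noteq> (\<lambda>_. 0)"
    by (auto simp: topologically_prime_def nonneutral_def)
  \<comment> \<open>Primality is applied to the expansion of \<open>p\<close> itself into unit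
    vectors.\<close>
  have "p divides\<^bsub>Z\<^esub> p" using pZ(1) by (intro Z.divides_refl) simp
  with p has_product_unit_vectors_fst[OF pZ(1)]
  obtain x where "x \<in> map_prod unit_vector id ` atom_copies H p" "p divides\<^bsub>Z\<^esub> fst x"
    unfolding topologically_prime_def by blast
  then obtain a where "a \<in> atoms H" "p divides\<^bsub>Z\<^esub> unit_vector a"
    by (auto simp: atom_copies_def)
  with pZ(2) show "p \<in> unit_vector ` atoms H"
    using le_unit_vector[of p a] divides_Z_le by blast
qed (use topologically_prime_unit_vector in blast)

section \<open>Uniqueness of factorisations\<close>

lemma topologically_prime_factorisation_multiplicity:
  assumes fac: "topologically_prime_factorisation Z f J v" and a: "a \<in> atoms H"
  shows "finite {j \<in> J. f j = unit_vector a} \<and> card {j \<in> J. f j = unit_vector a} = v a"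
proof -
  let ?M = "\<lambda>T. {j \<in> T. f j = unit_vector a}"
  have hp: "has_product Z f J v" using fac by (simp add: topologically_prime_factorisation_def)
  \<comment> \<open>Every member of the family is a unit vector, so its value at \<open>a\<close> is
    the indicator of being \<open>unit_vector a\<close>, and partial sums at \<open>a\<close> count
    occurrences.\<close>
  have coord: "f j a = (if f j = unit_vector a then 1 else 0)" if "j \<in> J" for j
  proof -
    from fac that obtain b where "f j = unit_vector b"
      by (auto simp: topologically_prime_factorisation_def topologically_prime_Z_iff)
    then show ?thesis using injD[OF inj_unit_vector, of b a] by (auto simp: unit_vector_def)
  qed
  obtain S where S: "finite S" "S \<subseteq> J"
    "\<And>T. finite T \<Longrightarrow> S \<subseteq> T \<Longrightarrow> T \<subseteq> J \<Longrightarrow> (\<Sum>t\<in>T. f t a) = v a"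
    by (rule has_product_Z_coordinate[OF hp a]) (rule that)
  have card: "card (?M T) = v a" if "finite T" "S \<subseteq> T" "T \<subseteq> J" for T
  proof -
    have "(\<Sum>t\<in>T. f t a) = (\<Sum>t\<in>T. if f t = unit_vector a then 1 else 0)"
      using that(3) by (intro sum.cong refl coord) blast
    also have "\<dots> = card (?M T)" using that(1) by (simp add: sum.If_cases Int_def)
    finally show ?thesis using S(3)[OF that] by simp
  qed
  \<comment> \<open>An occurrence outside \<open>S\<close> would raise the count by one, although it
    is \<open>v a\<close> both on \<open>S\<close> and on \<open>insert i S\<close>. The inclusion
    yields finiteness, which \<open>card\<close> alone cannot show as it is 0 on infinite
    sets.\<close>
  have "?M J \<subseteq> S"
  proof (rule ccontr)
    assume "\<not> ?M J \<subseteq> S"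
    then obtain i where i: "i \<in> J" "f i = unit_vector a" "i \<notin> S" by blast
    then have "?M (insert i S) = insert i (?M S)" by auto
    with i S(1) have "card (?M (insert i S)) = Suc (card (?M S))" by simp
    moreover have "card (?M S) = v a" "card (?M (insert i S)) = v a"
      by (rule card; use S(1,2) i(1) in auto)+
    ultimately show False by simp
  qed
  with S(2) have "?M J = ?M S" by blast
  with card[of S] S show ?thesis by simp
qed

lemma topologically_prime_factorial_Z: "topologically_prime_factorial TYPE('i) TYPE('j) Z"
  unfolding topologically_prime_factorial_def
proof (intro conjI ballI allI impI)
  fix v assume "v \<in> nonneutral Z"
  then have "has_product Z fst (map_prod unit_vector id ` atom_copies H v) v"
    by (intro has_product_unit_vectors_fst) (simp add: nonneutral_def)
  then have "topologically_prime_factorisation Z fst (map_prod unit_vector id ` atom_copies H v) v"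
    by (auto simp: topologically_prime_factorisation_def topologically_prime_Z_iff atom_copies_def)
  then show "\<exists>(a :: ('a \<Rightarrow> nat) \<times> nat \<Rightarrow> 'a \<Rightarrow> nat) J. topologically_prime_factorisation Z a J v"
    by blast
next
  fix v and a :: "'i \<Rightarrow> 'a \<Rightarrow> nat" and I and b :: "'j \<Rightarrow> 'a \<Rightarrow> nat" and J
  assume a: "topologically_prime_factorisation Z a I v"
    and b: "topologically_prime_factorisation Z b J v"
  show "equivalent_factorisations Z a I b J"
    unfolding equivalent_factorisations_def
  proof
    fix h
    show "{i \<in> I. a i = h} \<approx> {j \<in> J. b j = h}"
    proof (cases "h \<in> unit_vector ` atoms H")
      case True
      then show ?thesis
        using topologically_prime_factorisation_multiplicity[OF a]
          topologically_prime_factorisation_multiplicity[OF b] by (auto simp: eqpoll_iff_card)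
    next
      \<comment> \<open>Both families consist of unit vectors of atoms, so neither takes the value
        \<open>h\<close>.\<close>
      case False
      then have "{i \<in> I. a i = h} = {}" "{j \<in> J. b j = h} = {}"
        using a b by (auto simp: topologically_prime_factorisation_def topologically_prime_Z_iff)
      then show ?thesis by (simp only: eqpoll_def bij_betw_def) simp
    qed
  qed
qed

end

theorem theorem4p10:
  fixes H :: "('a, 'm) top_monoid_scheme"
  assumes "topological_comm_monoid H"
    and "Hausdorff_space (topo H)"
    and "comm_monoid_cancel H"
    and "reduced_monoid H"
    and "allows_arbitrary_decimation H"
  shows "topologically_prime_factorial TYPE('i) TYPE('j) (Z_monoid H)"
proof -
  interpret topological_comm_monoid H by fact
  interpret decimable_monoid H by unfold_locales fact+
  show ?thesis by (rule topologically_prime_factorial_Z)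
qed

end
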